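(* Let $X$ be a finite alphabet, $\mathcal{P}=\mathbb{Z}\langle X\rangle$ with a fixed monomial well-ordering, let $m\in\mathbb{Z}\setminus\{0\}$, and let $\pi:\mathbb{Z}\langle X\rangle\to(\mathbb{Z}/m\mathbb{Z})\langle X\rangle$ be the canonical projection. Let $\mathcal{I}$ be a two-sided ideal of $\mathcal{P}$ and let $\mathcal{G}\subseteq\mathcal{P}$ be such that $\pi(\mathcal{G})$ is a strong Gröbner basis of $\pi(\mathcal{I})$. Assume additionally that $m\nmid\mathrm{lc}(g)$ and $\mathrm{lc}(g)\mid m$ for every $g\in\mathcal{G}$. Then $\mathcal{G}\cup\{m\}$ is a strong Gröbner basis for $\mathcal{I}+m\mathcal{P}$.
   Context: **Notation.** For a commutative ring $\mathcal{R}$ (here $\mathbb{Z}$ or $\mathbb{Z}/m\mathbb{Z}$), $\mathcal{R}\langle X\rangle$ is the free associative algebra with $\mathcal{R}$-basis the free monoid $\mathcal{B}=\langle X\rangle$ of words (monomials). $\mathrm{lm},\mathrm{lc},\mathrm{lt}=\mathrm{lc}\cdot\mathrm{lm}$ denote leading monomial, coefficient and term with respect to the fixed ordering. A word $u$ divides a word $v$ if $v=puq$ for some words $p,q$; a term $c\,u$ divides a term $c'v$ if $c\mid c'$ in $\mathcal{R}$ and $u$ divides $v$. **Strong Gröbner basis.** For $\mathcal{S}\subseteq\mathcal{R}\langle X\rangle$ let $\mathrm{L}(\mathcal{S})=\langle\mathrm{lt}(f):f\in\mathcal{S}\setminus\{0\}\rangle$ (two-sided ideal). A countable set $\mathcal{G}\subseteq\mathcal{I}\setminus\{0\}$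 is a strong Gröbner basis for a two-sided ideal $\mathcal{I}$ if $\mathrm{L}(\mathcal{I})\subseteq\mathrm{L}(\mathcal{G})$ and for every $f'\in\mathcal{I}\setminus\{0\}$ there is $g'\in\mathcal{G}$ with $\mathrm{lt}(g')$ dividing $\mathrm{lt}(f')$. *)

theory Defs
  imports "HOL-Algebra.IntRing" "HOL-Algebra.Divisibility" "HOL-Library.Sublist" "HOL-Library.Countable_Set"
begin

text \<open>
  An element of the free associative algebra over \<open>R\<close> on the alphabet \<open>X\<close> is represented by its
  coefficient function on words; words over \<open>X\<close> are the lists in \<^term>\<open>lists X\<close>, and lists
  with letters outside \<open>X\<close> have coefficient zero.
\<close>

definition free_alg :: "('a, 'b) ring_scheme \<Rightarrow> 'x set \<Rightarrow> ('x list \<Rightarrow> 'a) ring" where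
  "free_alg R X = \<lparr>
     carrier = {f. (\<forall>w. f w \<in> carrier R) \<and> finite {w. f w \<noteq> \<zero>\<^bsub>R\<^esub>} \<and> {w. f w \<noteq> \<zero>\<^bsub>R\<^esub>} \<subseteq> lists X},
     mult = (\<lambda>f g w. \<Oplus>\<^bsub>R\<^esub>i\<in>{..length w}. f (take i w) \<otimes>\<^bsub>R\<^esub> g (drop i w)),
     one = (\<lambda>w. if w = [] then \<one>\<^bsub>R\<^esub> else \<zero>\<^bsub>R\<^esub>),
     zero = (\<lambda>w. \<zero>\<^bsub>R\<^esub>),
     add = (\<lambda>f g w. f w \<oplus>\<^bsub>R\<^esub> g w)\<rparr>"

lemma (in abelian_monoid) finsum_triangle:
  fixes n :: nat
  assumes "\<And>i j. F i j \<in> carrier G"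
  shows "(\<Oplus>i\<in>{..n}. \<Oplus>j\<in>{..i}. F j i) = (\<Oplus>j\<in>{..n}. \<Oplus>k\<in>{..n-j}. F j (j+k))"
proof (induction n)
  case 0
  then show ?case by (simp add: assms)
next
  case (Suc n)
  have "(\<Oplus>j\<in>{..n}. \<Oplus>k\<in>{..Suc n-j}. F j (j+k)) = (\<Oplus>j\<in>{..n}. F j (Suc n) \<oplus> (\<Oplus>k\<in>{..n-j}. F j (j+k)))"
    by (rule finsum_cong') (auto simp: assms Pi_def Suc_diff_le)
  also have "\<dots> = (\<Oplus>j\<in>{..n}. F j (Suc n)) \<oplus> (\<Oplus>j\<in>{..n}. \<Oplus>k\<in>{..n-j}. F j (j+k))"
    by (rule finsum_addf) (auto simp: assms Pi_def)
  finally have *: "(\<Oplus>j\<in>{..n}. \<Oplus>k\<in>{..Suc n-j}. F j (j+k)) = \<dots>" .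
  show ?case
    by (simp add: * Suc assms Pi_def a_ac)
qed

lemma (in ring) free_alg_ring: "ring (free_alg R X)"
proof -
  let ?A = "free_alg R X"
  have mc: "f \<otimes>\<^bsub>?A\<^esub> g \<in> carrier ?A" if f: "f \<in> carrier ?A" and g: "g \<in> carrier ?A" for f g
  proof -
    have fg: "f w \<in> carrier R" "g w \<in> carrier R" for w using f g by (auto simp: free_alg_def)
    have "\<exists>i. f (take i w) \<noteq> \<zero> \<and> g (drop i w) \<noteq> \<zero>" if "(f \<otimes>\<^bsub>?A\<^esub> g) w \<noteq> \<zero>" for w
    proof (rule ccontr)
      assume "\<not> ?thesis"
      then have "f (take i w) \<otimes> g (drop i w) = \<zero>" for i
        using fg by (metis l_null r_null)
      then show False using that by (simp add: free_alg_def)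
    qed
    then have "w \<in> (\<lambda>(u,v). u @ v) ` ({w. f w \<noteq> \<zero>} \<times> {w. g w \<noteq> \<zero>})" 
      if "(f \<otimes>\<^bsub>?A\<^esub> g) w \<noteq> \<zero>" for w
      using that by (force simp: image_iff)
    then have s: "{w. (f \<otimes>\<^bsub>?A\<^esub> g) w \<noteq> \<zero>} \<subseteq> (\<lambda>(u,v). u @ v) ` ({w. f w \<noteq> \<zero>} \<times> {w. g w \<noteq> \<zero>})"
      by blast
    have fin: "finite {w. f w \<noteq> \<zero>}" "finite {w. g w \<noteq> \<zero>}" 
      and lst: "{w. f w \<noteq> \<zero>} \<subseteq> lists X" "{w. g w \<noteq> \<zero>} \<subseteq> lists X"
      using f g by (auto simp: free_alg_def)
    have 1: "finite {w. (f \<otimes>\<^bsub>?A\<^esub> g) w \<noteq> \<zero>}"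
      by (rule finite_subset[OF s]) (use fin in auto)
    have "(\<lambda>(u,v). u @ v) ` ({w. f w \<noteq> \<zero>} \<times> {w. g w \<noteq> \<zero>}) \<subseteq> lists X" using lst by (auto simp: subset_iff in_lists_conv_set)
    then have 2: "{w. (f \<otimes>\<^bsub>?A\<^esub> g) w \<noteq> \<zero>} \<subseteq> lists X" using s by (rule subset_trans[rotated])
    show ?thesis using 1 2 fg by (simp add: free_alg_def)
  qed
  have cr: "f w \<in> carrier R" if "f \<in> carrier ?A" for f w using that by (simp add: free_alg_def)
  have ac: "f \<oplus>\<^bsub>?A\<^esub> g \<in> carrier ?A" if f: "f \<in> carrier ?A" and g: "g \<in> carrier ?A" for f g
  proof -
    have "{w. f w \<oplus> g w \<noteq> \<zero>} \<subseteq> {w. f w \<noteq> \<zero>} \<union> {w. g w \<noteq> \<zero>}" by auto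
    moreover have "finite ({w. f w \<noteq> \<zero>} \<union> {w. g w \<noteq> \<zero>})" "{w. f w \<noteq> \<zero>} \<union> {w. g w \<noteq> \<zero>} \<subseteq> lists X"
      using f g by (auto simp: free_alg_def)
    ultimately have "finite {w. f w \<oplus> g w \<noteq> \<zero>}" "{w. f w \<oplus> g w \<noteq> \<zero>} \<subseteq> lists X"
      apply (metis finite_subset) by (use \<open>{w. f w \<oplus> g w \<noteq> \<zero>} \<subseteq> _\<close> \<open>_ \<subseteq> lists X\<close> in blast)
    then show ?thesis using f g by (simp add: free_alg_def)
  qed
  have zc: "\<zero>\<^bsub>?A\<^esub> \<in> carrier ?A" by (simp add: free_alg_def)
  have oc: "\<one>\<^bsub>?A\<^esub> \<in> carrier ?A" 
    using finite_subset[of "{w::'c list. (w = [] \<longrightarrow> \<one> \<noteq> \<zero>) \<and> w = []}" "{[]}"] by (auto simp: free_alg_def)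
  have ag: "abelian_group ?A"
  proof (rule abelian_groupI)
    fix f assume f: "f \<in> carrier ?A"
    have "(\<lambda>w. \<ominus> f w) \<in> carrier ?A"
    proof -
      have "{w. \<ominus> f w \<noteq> \<zero>} = {w. f w \<noteq> \<zero>}" using cr[OF f] by (metis add.inv_eq_1_iff)
      then show ?thesis using f by (simp add: free_alg_def)
    qed
    moreover have "(\<lambda>w. \<ominus> f w) \<oplus>\<^bsub>?A\<^esub> f = \<zero>\<^bsub>?A\<^esub>"
      using cr[OF f] by (simp add: free_alg_def l_neg)
    ultimately show "\<exists>y\<in>carrier ?A. y \<oplus>\<^bsub>?A\<^esub> f = \<zero>\<^bsub>?A\<^esub>" by blast
  qed (use ac zc in \<open>auto simp: free_alg_def a_ac\<close>)
  have mo: "Group.monoid ?A"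
  proof (rule monoidI)
    fix f g h assume fgh: "f \<in> carrier ?A" "g \<in> carrier ?A" "h \<in> carrier ?A"
    note c = fgh[THEN cr]
    show "f \<otimes>\<^bsub>?A\<^esub> g \<otimes>\<^bsub>?A\<^esub> h = f \<otimes>\<^bsub>?A\<^esub> (g \<otimes>\<^bsub>?A\<^esub> h)"
    proof
      fix w
      define F where "F j i = f (take j w) \<otimes> g (take (i-j) (drop j w)) \<otimes> h (drop i w)" for i j
      have "(f \<otimes>\<^bsub>?A\<^esub> g \<otimes>\<^bsub>?A\<^esub> h) w = (\<Oplus>i\<in>{..length w}. (\<Oplus>j\<in>{..i}. F j i))"
        unfolding free_alg_def F_def
        by (simp, rule finsum_cong') (auto simp: Pi_def c finsum_ldistr min_absorb2 min_absorb1 drop_take intro!: finsum_cong')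
      also have "\<dots> = (\<Oplus>j\<in>{..length w}. \<Oplus>k\<in>{..length w - j}. F j (j+k))"
        by (rule finsum_triangle) (simp add: F_def c)
      also have "\<dots> = (f \<otimes>\<^bsub>?A\<^esub> (g \<otimes>\<^bsub>?A\<^esub> h)) w"
        unfolding free_alg_def F_def
        by (simp, rule finsum_cong') (auto simp: Pi_def c finsum_rdistr m_assoc add.commute intro!: finsum_cong')
      finally show "(f \<otimes>\<^bsub>?A\<^esub> g \<otimes>\<^bsub>?A\<^esub> h) w = (f \<otimes>\<^bsub>?A\<^esub> (g \<otimes>\<^bsub>?A\<^esub> h)) w" .
    qed
  next
    fix f assume f: "f \<in> carrier ?A"
    note c = cr[OF f]
    show "\<one>\<^bsub>?A\<^esub> \<otimes>\<^bsub>?A\<^esub> f = f"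
    proof
      fix w
      have "(\<one>\<^bsub>?A\<^esub> \<otimes>\<^bsub>?A\<^esub> f) w = (\<Oplus>i\<in>{..length w}. if 0 = i then f w else \<zero>)"
        unfolding free_alg_def by (simp, rule finsum_cong') (auto simp: c)
      also have "\<dots> = f w" by (rule add.finprod_singleton) (auto simp: c)
      finally show "(\<one>\<^bsub>?A\<^esub> \<otimes>\<^bsub>?A\<^esub> f) w = f w" .
    qed
    show "f \<otimes>\<^bsub>?A\<^esub> \<one>\<^bsub>?A\<^esub> = f"
    proof
      fix w
      have "(f \<otimes>\<^bsub>?A\<^esub> \<one>\<^bsub>?A\<^esub>) w = (\<Oplus>i\<in>{..length w}. if length w = i then f w else \<zero>)"
        unfolding free_alg_def by (simp, rule finsum_cong') (auto simp: c)
      also have "\<dots> = f w" by (rule add.finprod_singleton) (auto simp: c)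
      finally show "(f \<otimes>\<^bsub>?A\<^esub> \<one>\<^bsub>?A\<^esub>) w = f w" .
    qed
  qed (use mc oc in auto)
  show ?thesis
  proof (rule ringI[OF ag mo])
    fix f g h assume fgh: "f \<in> carrier ?A" "g \<in> carrier ?A" "h \<in> carrier ?A"
    note c = fgh[THEN cr]
    show "(f \<oplus>\<^bsub>?A\<^esub> g) \<otimes>\<^bsub>?A\<^esub> h = f \<otimes>\<^bsub>?A\<^esub> h \<oplus>\<^bsub>?A\<^esub> g \<otimes>\<^bsub>?A\<^esub> h"
      using c by (auto simp: free_alg_def l_distr Pi_def finsum_addf)
    show "h \<otimes>\<^bsub>?A\<^esub> (f \<oplus>\<^bsub>?A\<^esub> g) = h \<otimes>\<^bsub>?A\<^esub> f \<oplus>\<^bsub>?A\<^esub> h \<otimes>\<^bsub>?A\<^esub> g"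
      using c by (auto simp: free_alg_def r_distr Pi_def finsum_addf)
  qed
qed

definition word_term :: "('a, 'b) ring_scheme \<Rightarrow> 'a \<Rightarrow> 'x list \<Rightarrow> 'x list \<Rightarrow> 'a" where
  "word_term R c u = (\<lambda>w. if w = u then c else \<zero>\<^bsub>R\<^esub>)"

text \<open>
  Orderings are given as the reflexive relations of the library: \<open>(u, v) \<in> r\<close> means that
  \<open>u\<close> is at most \<open>v\<close>. Since words can be cancelled, compatibility of the reflexive relation
  with concatenation is equivalent to compatibility of its strict part.
\<close>

definition monomial_well_order :: "'x set \<Rightarrow> 'x list rel \<Rightarrow> bool" where
  "monomial_well_order X r \<longleftrightarrow> well_order_on (lists X) r \<and>
     (\<forall>u v. \<forall>p\<in>lists X. \<forall>q\<in>lists X. (u, v) \<in> r \<longrightarrow> (p @ u @ q, p @ v @ q) \<in> r)"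

definition lead_mon :: "('a, 'b) ring_scheme \<Rightarrow> 'x list rel \<Rightarrow> ('x list \<Rightarrow> 'a) \<Rightarrow> 'x list" where
  "lead_mon R r f = (THE u. f u \<noteq> \<zero>\<^bsub>R\<^esub> \<and> (\<forall>v. f v \<noteq> \<zero>\<^bsub>R\<^esub> \<longrightarrow> (v, u) \<in> r))"

definition lead_coef :: "('a, 'b) ring_scheme \<Rightarrow> 'x list rel \<Rightarrow> ('x list \<Rightarrow> 'a) \<Rightarrow> 'a" where
  "lead_coef R r f = f (lead_mon R r f)"

definition lead_term :: "('a, 'b) ring_scheme \<Rightarrow> 'x list rel \<Rightarrow> ('x list \<Rightarrow> 'a) \<Rightarrow> 'x list \<Rightarrow> 'a" where
  "lead_term R r f = word_term R (lead_coef R r f) (lead_mon R r f)"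

text \<open>A word divides another one iff it is a contiguous sublist of it.\<close>

definition term_divides :: "('a, 'b) ring_scheme \<Rightarrow> ('x list \<Rightarrow> 'a) \<Rightarrow> ('x list \<Rightarrow> 'a) \<Rightarrow> bool" where
  "term_divides R s t \<longleftrightarrow>
     (\<exists>c u c' v. s = word_term R c u \<and> t = word_term R c' v \<and> c divides\<^bsub>R\<^esub> c' \<and> sublist u v)"

definition lead_ideal ::
  "('a, 'b) ring_scheme \<Rightarrow> 'x set \<Rightarrow> 'x list rel \<Rightarrow> ('x list \<Rightarrow> 'a) set \<Rightarrow> ('x list \<Rightarrow> 'a) set" where
  "lead_ideal R X r S =
     Idl\<^bsub>free_alg R X\<^esub> (lead_term R r ` (S - {\<zero>\<^bsub>free_alg R X\<^esub>}))"

text \<open>The library's \<^const>\<open>ideal\<close> is two-sided.\<close>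

definition strong_groebner_basis ::
  "('a, 'b) ring_scheme \<Rightarrow> 'x set \<Rightarrow> 'x list rel \<Rightarrow> ('x list \<Rightarrow> 'a) set \<Rightarrow> ('x list \<Rightarrow> 'a) set \<Rightarrow> bool" where
  "strong_groebner_basis R X r G I \<longleftrightarrow>
     ideal I (free_alg R X) \<and>
     countable G \<and> G \<subseteq> I - {\<zero>\<^bsub>free_alg R X\<^esub>} \<and>
     lead_ideal R X r I \<subseteq> lead_ideal R X r G \<and>
     (\<forall>f\<in>I - {\<zero>\<^bsub>free_alg R X\<^esub>}. \<exists>g\<in>G. term_divides R (lead_term R r g) (lead_term R r f))"

text \<open>
  Coefficientwise reduction, with values in \<^term>\<open>free_alg (ZFact m) X\<close>.
\<close>

definition proj_mod :: "int \<Rightarrow> ('x list \<Rightarrow> int) \<Rightarrow> 'x list \<Rightarrow> int set" where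
  "proj_mod m f = (\<lambda>w. (Idl\<^bsub>\<Z>\<^esub> {m}) +>\<^bsub>\<Z>\<^esub> f w)"

end

theory Submission
  imports Defs
begin

text \<open>
  Write \<open>P\<close> for the free algebra over \<open>\<int>\<close> and \<open>J = I + mP\<close>. Since \<open>mP\<close> is the kernel of the
  reduction \<open>\<pi>\<close>, the ideal \<open>J\<close> is the full preimage of \<open>\<pi> I\<close>
  (\<open>mem_ideal_plus_multiples_iff\<close>), so the Groebner basis property of \<open>\<pi> G\<close> can be applied to
  the reduction of any element of \<open>J\<close>.

  Let \<open>f \<in> J\<close> be nonzero. If \<open>m\<close> divides \<open>lc f\<close>, then the constant \<open>m\<close> divides the leading term
  of \<open>f\<close>. Otherwise the leading coefficient of \<open>f\<close> survives the reduction, so \<open>f\<close> and \<open>\<pi> f\<close> have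
  the same leading monomial (\<open>lead_term_proj_mod\<close>); the same holds for every \<open>g \<in> G\<close>. A \<open>g\<close> for which
  \<open>lt (\<pi> g)\<close> divides \<open>lt (\<pi> f)\<close> therefore satisfies \<open>lm g | lm f\<close> and \<open>lc f \<equiv> lc g \<cdot> e (mod m)\<close> for
  some \<open>e\<close>, and \<open>lc g | m\<close> turns this congruence into the divisibility \<open>lc g | lc f\<close> over \<open>\<int>\<close>
  (\<open>term_divides_lift\<close>).

  The inclusion of leading ideals follows from this divisibility of leading terms over every ring
  (\<open>lead_ideal_subset\<close>). Countability of \<open>G\<close> is not a consequence of countability of \<open>\<pi> G\<close>, because
  a fibre of \<open>\<pi>\<close> may be infinite; it holds because \<open>P\<close> itself is countable.
\<close>

section \<open>Terms in the free algebra\<close>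

lemma free_alg_mult:
  "mult (free_alg R X) f g = (\<lambda>w. \<Oplus>\<^bsub>R\<^esub>i\<in>{..length w}. f (take i w) \<otimes>\<^bsub>R\<^esub> g (drop i w))"
  by (simp add: free_alg_def)

lemma free_alg_simps:
  "add (free_alg R X) f g = (\<lambda>w. f w \<oplus>\<^bsub>R\<^esub> g w)"
  "zero (free_alg R X) = (\<lambda>w. \<zero>\<^bsub>R\<^esub>)"
  by (simp_all add: free_alg_def)

lemma free_alg_coeff_closed: "f \<in> carrier (free_alg R X) \<Longrightarrow> f w \<in> carrier R"
  by (simp add: free_alg_def)

lemma free_alg_support:
  assumes "f \<in> carrier (free_alg R X)"
  shows "finite {w. f w \<noteq> \<zero>\<^bsub>R\<^esub>}" and "f w \<noteq> \<zero>\<^bsub>R\<^esub> \<Longrightarrow> w \<in> lists X"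
  using assms by (auto simp: free_alg_def)

lemma word_term_in_carrier:
  assumes "ring R" "c \<in> carrier R" "u \<in> lists X"
  shows "word_term R c u \<in> carrier (free_alg R X)"
proof -
  interpret ring R by fact
  have "{w. word_term R c u w \<noteq> \<zero>\<^bsub>R\<^esub>} \<subseteq> {u}" by (auto simp: word_term_def)
  then show ?thesis
    using assms finite_subset[of _ "{u}"] by (auto simp: free_alg_def word_term_def)
qed

lemma word_term_inject:
  assumes "word_term R c u = word_term R c' u'" "c \<noteq> \<zero>\<^bsub>R\<^esub>"
  shows "c = c'" "u = u'"
  using fun_cong[OF assms(1), of u] assms(2) by (auto simp: word_term_def split: if_splits)

lemma word_term_mult_word_term:
  assumes "ring R" "a \<in> carrier R" "b \<in> carrier R"
  shows "word_term R a u \<otimes>\<^bsub>free_alg R X\<^esub> word_term R b v = word_term R (a \<otimes>\<^bsub>R\<^esub> b) (u @ v)"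
proof
  interpret ring R by fact
  fix w
  \<comment> \<open>Only the cut after \<open>u\<close> can contribute to the convolution sum, and only if \<open>w = u @ v\<close>.\<close>
  have split: "take i w = u \<and> drop i w = v \<longleftrightarrow> length u = i \<and> w = u @ v" if "i \<le> length w" for i
    using that by (metis append_eq_conv_conj append_take_drop_id length_take min.absorb2)
  have "(\<Oplus>\<^bsub>R\<^esub>i\<in>{..length w}. word_term R a u (take i w) \<otimes>\<^bsub>R\<^esub> word_term R b v (drop i w))
      = (\<Oplus>\<^bsub>R\<^esub>i\<in>{..length w}. if length u = i then (if w = u @ v then a \<otimes>\<^bsub>R\<^esub> b else \<zero>\<^bsub>R\<^esub>) else \<zero>\<^bsub>R\<^esub>)"
    (is "_ = (\<Oplus>\<^bsub>R\<^esub>i\<in>_. ?F i)")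
  proof (rule finsum_cong')
    fix i assume "i \<in> {..length w}"
    then have i: "i \<le> length w" by simp
    show "word_term R a u (take i w) \<otimes>\<^bsub>R\<^esub> word_term R b v (drop i w) = ?F i"
      using split[OF i] assms by (auto simp: word_term_def)
  qed (use assms in \<open>auto simp: Pi_def\<close>)
  also have "\<dots> = word_term R (a \<otimes>\<^bsub>R\<^esub> b) (u @ v) w"
  proof (cases "w = u @ v")
    case True
    then show ?thesis
      using add.finprod_singleton[of "length u" "{..length w}" "\<lambda>_. a \<otimes>\<^bsub>R\<^esub> b"] assms
      by (simp add: word_term_def)
  next
    case False
    then have "(\<Oplus>\<^bsub>R\<^esub>i\<in>{..length w}. ?F i) = (\<Oplus>\<^bsub>R\<^esub>i\<in>{..length w}. \<zero>\<^bsub>R\<^esub>)"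
      by (intro finsum_cong') auto
    then show ?thesis using False by (simp add: word_term_def)
  qed
  finally show "(word_term R a u \<otimes>\<^bsub>free_alg R X\<^esub> word_term R b v) w = word_term R (a \<otimes>\<^bsub>R\<^esub> b) (u @ v) w"
    by (simp add: free_alg_mult)
qed

lemma constant_mult:
  assumes "ring R" "c \<in> carrier R" "f \<in> carrier (free_alg R X)"
  shows "word_term R c [] \<otimes>\<^bsub>free_alg R X\<^esub> f = (\<lambda>w. c \<otimes>\<^bsub>R\<^esub> f w)"
    and "f \<otimes>\<^bsub>free_alg R X\<^esub> word_term R c [] = (\<lambda>w. f w \<otimes>\<^bsub>R\<^esub> c)"
proof -
  interpret ring R by fact
  note f = free_alg_coeff_closed[OF assms(3)]
  show "word_term R c [] \<otimes>\<^bsub>free_alg R X\<^esub> f = (\<lambda>w. c \<otimes>\<^bsub>R\<^esub> f w)"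
  proof
    fix w
    have "(word_term R c [] \<otimes>\<^bsub>free_alg R X\<^esub> f) w
        = (\<Oplus>\<^bsub>R\<^esub>i\<in>{..length w}. if 0 = i then c \<otimes>\<^bsub>R\<^esub> f w else \<zero>\<^bsub>R\<^esub>)"
      unfolding free_alg_mult
      by (rule finsum_cong') (auto simp: word_term_def f assms)
    also have "\<dots> = c \<otimes>\<^bsub>R\<^esub> f w"
      by (rule add.finprod_singleton) (auto simp: f assms)
    finally show "(word_term R c [] \<otimes>\<^bsub>free_alg R X\<^esub> f) w = c \<otimes>\<^bsub>R\<^esub> f w" .
  qed
  show "f \<otimes>\<^bsub>free_alg R X\<^esub> word_term R c [] = (\<lambda>w. f w \<otimes>\<^bsub>R\<^esub> c)"
  proof
    fix w
    have "(f \<otimes>\<^bsub>free_alg R X\<^esub> word_term R c []) w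
        = (\<Oplus>\<^bsub>R\<^esub>i\<in>{..length w}. if length w = i then f w \<otimes>\<^bsub>R\<^esub> c else \<zero>\<^bsub>R\<^esub>)"
      unfolding free_alg_mult
      by (rule finsum_cong') (auto simp: word_term_def f assms)
    also have "\<dots> = f w \<otimes>\<^bsub>R\<^esub> c"
      by (rule add.finprod_singleton) (auto simp: f assms)
    finally show "(f \<otimes>\<^bsub>free_alg R X\<^esub> word_term R c []) w = f w \<otimes>\<^bsub>R\<^esub> c" .
  qed
qed

text \<open>
  An element is determined by its graph over its support, which is a finite subset of the
  countable set of all pairs of a word and a coefficient.
\<close>

lemma countable_free_alg:
  assumes "countable X" "countable (carrier R)"
  shows "countable (carrier (free_alg R X))"
proof -
  define graph where "graph f = {(w, f w) | w. f w \<noteq> \<zero>\<^bsub>R\<^esub>}" for f :: "'a list \<Rightarrow> 'b"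
  have "graph f \<in> {A. A \<subseteq> lists X \<times> carrier R \<and> finite A}"
    if f: "f \<in> carrier (free_alg R X)" for f
  proof -
    have "graph f = (\<lambda>w. (w, f w)) ` {w. f w \<noteq> \<zero>\<^bsub>R\<^esub>}" by (auto simp: graph_def)
    then show ?thesis
      using free_alg_support[OF f] free_alg_coeff_closed[OF f] by auto
  qed
  then have "graph ` carrier (free_alg R X) \<subseteq> {A. A \<subseteq> lists X \<times> carrier R \<and> finite A}" by blast
  moreover have "countable {A. A \<subseteq> lists X \<times> carrier R \<and> finite A}"
    using countable_Collect_finite_subset[of "lists X \<times> carrier R"] assms
    by (simp only: conj_commute) simp
  ultimately have "countable (graph ` carrier (free_alg R X))" by (rule countable_subset)
  moreover have "f = g" if "graph f = graph g" for f g
  proof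
    fix w
    have "(w, z) \<in> graph f \<longleftrightarrow> (w, z) \<in> graph g" for z using that by simp
    then show "f w = g w" unfolding graph_def by (simp, metis)
  qed
  then have "inj_on graph (carrier (free_alg R X))" by (auto intro: inj_onI)
  ultimately show ?thesis by (rule countable_image_inj_on)
qed

section \<open>Leading terms\<close>

lemma lead_mon_eqI:
  assumes "well_order_on (lists X) r"
    and "f u \<noteq> \<zero>\<^bsub>R\<^esub>" "\<And>v. f v \<noteq> \<zero>\<^bsub>R\<^esub> \<Longrightarrow> (v, u) \<in> r"
  shows "lead_mon R r f = u"
proof -
  have "antisym r"
    using assms(1) by (simp add: well_order_on_def linear_order_on_def partial_order_on_def)
  then show ?thesis
    unfolding lead_mon_def using assms(2,3) by (intro the_equality) (auto dest: antisymD)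
qed

lemma linear_order_on_finite_has_max:
  assumes "linear_order_on A r" "finite S" "S \<noteq> {}" "S \<subseteq> A"
  shows "\<exists>u\<in>S. \<forall>v\<in>S. (v, u) \<in> r"
  using assms(2-4)
proof (induction S rule: finite_ne_induct)
  case (singleton x)
  then show ?case
    using assms(1) by (auto simp: linear_order_on_def partial_order_on_def preorder_on_def refl_on_def)
next
  case (insert x S)
  then obtain u where u: "u \<in> S" "\<forall>v\<in>S. (v, u) \<in> r" by auto
  have xx: "(x, x) \<in> r" and tr: "trans r" and tot: "(x, u) \<in> r \<or> (u, x) \<in> r"
    using assms(1) insert.prems u(1) insert.hyps(3)
    by (auto simp: linear_order_on_def partial_order_on_def preorder_on_def refl_on_def total_on_def)
  then show ?case using u by (metis insert_iff transD)
qed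

lemma
  assumes "well_order_on (lists X) r" and f: "f \<in> carrier (free_alg R X)"
    and nz: "f \<noteq> \<zero>\<^bsub>free_alg R X\<^esub>"
  shows lead_coef_nonzero: "lead_coef R r f \<noteq> \<zero>\<^bsub>R\<^esub>"
    and lead_mon_greatest: "f v \<noteq> \<zero>\<^bsub>R\<^esub> \<Longrightarrow> (v, lead_mon R r f) \<in> r"
proof -
  have "\<exists>u\<in>{w. f w \<noteq> \<zero>\<^bsub>R\<^esub>}. \<forall>v\<in>{w. f w \<noteq> \<zero>\<^bsub>R\<^esub>}. (v, u) \<in> r"
    using assms free_alg_support[OF f]
    by (intro linear_order_on_finite_has_max[of "lists X"])
      (auto simp: well_order_on_def free_alg_simps fun_eq_iff)
  then obtain u where u: "f u \<noteq> \<zero>\<^bsub>R\<^esub>" "\<And>v. f v \<noteq> \<zero>\<^bsub>R\<^esub> \<Longrightarrow> (v, u) \<in> r" by auto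
  have "lead_mon R r f = u" using assms(1) u by (rule lead_mon_eqI)
  then show "lead_coef R r f \<noteq> \<zero>\<^bsub>R\<^esub>" "f v \<noteq> \<zero>\<^bsub>R\<^esub> \<Longrightarrow> (v, lead_mon R r f) \<in> r"
    using u by (auto simp: lead_coef_def)
qed

lemma lead_mon_in_lists:
  assumes "well_order_on (lists X) r" "f \<in> carrier (free_alg R X)" "f \<noteq> \<zero>\<^bsub>free_alg R X\<^esub>"
  shows "lead_mon R r f \<in> lists X"
  using lead_coef_nonzero[OF assms] free_alg_support(2)[OF assms(2)] by (simp add: lead_coef_def)

lemma lead_term_in_carrier:
  assumes "ring R" "well_order_on (lists X) r"
    and "f \<in> carrier (free_alg R X)" "f \<noteq> \<zero>\<^bsub>free_alg R X\<^esub>"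
  shows "lead_term R r f \<in> carrier (free_alg R X)"
  unfolding lead_term_def
  using assms lead_mon_in_lists[OF assms(2-4)]
  by (intro word_term_in_carrier) (auto simp: lead_coef_def free_alg_coeff_closed)

text \<open>
  A term determines its word only if its coefficient is nonzero: all terms with coefficient zero are
  the same function.
\<close>

lemma term_divides_word_term_iff:
  assumes "c \<noteq> \<zero>\<^bsub>R\<^esub>" "c' \<noteq> \<zero>\<^bsub>R\<^esub>"
  shows "term_divides R (word_term R c u) (word_term R c' v) \<longleftrightarrow> c divides\<^bsub>R\<^esub> c' \<and> sublist u v"
  unfolding term_divides_def using word_term_inject assms by metis

text \<open>
  If \<open>v = p u q\<close> and \<open>c' = c d\<close>, then \<open>c' v = p \<cdot> (c u) \<cdot> (d q)\<close>, so an ideal that contains a term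
  contains its multiples in the sense of term divisibility.
\<close>

lemma lead_ideal_subset:
  assumes R: "ring R" and r: "well_order_on (lists X) r"
    and I: "I \<subseteq> carrier (free_alg R X)"
    and G: "G \<subseteq> I - {\<zero>\<^bsub>free_alg R X\<^esub>}"
    and div: "\<And>f. f \<in> I - {\<zero>\<^bsub>free_alg R X\<^esub>} \<Longrightarrow>
               \<exists>g\<in>G. term_divides R (lead_term R r g) (lead_term R r f)"
  shows "lead_ideal R X r I \<subseteq> lead_ideal R X r G"
proof -
  interpret R: ring R by fact
  let ?A = "free_alg R X"
  interpret A: ring ?A by (rule R.free_alg_ring)
  have sub: "lead_term R r ` (G - {\<zero>\<^bsub>?A\<^esub>}) \<subseteq> carrier ?A"
    using lead_term_in_carrier[OF R r] G I by auto
  interpret L: ideal "lead_ideal R X r G" ?A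
    unfolding lead_ideal_def by (rule A.genideal_ideal[OF sub])
  have "lead_term R r f \<in> lead_ideal R X r G" if f: "f \<in> I - {\<zero>\<^bsub>?A\<^esub>}" for f
  proof -
    obtain g where g: "g \<in> G" and gf: "term_divides R (lead_term R r g) (lead_term R r f)"
      using div[OF f] by blast
    have fc: "f \<in> carrier ?A" "f \<noteq> \<zero>\<^bsub>?A\<^esub>" and gc: "g \<in> carrier ?A" "g \<noteq> \<zero>\<^bsub>?A\<^esub>"
      using f g G I by auto
    have lg: "lead_term R r g \<in> lead_ideal R X r G"
      unfolding lead_ideal_def using A.genideal_self[OF sub] g gc by auto
    have "lead_coef R r g divides\<^bsub>R\<^esub> lead_coef R r f" and sl: "sublist (lead_mon R r g) (lead_mon R r f)"
      using gf lead_coef_nonzero[OF r fc] lead_coef_nonzero[OF r gc]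
      by (auto simp: lead_term_def term_divides_word_term_iff)
    then obtain d where d: "d \<in> carrier R" "lead_coef R r f = lead_coef R r g \<otimes>\<^bsub>R\<^esub> d"
      by (auto simp: factor_def)
    from sl obtain p q where pq: "lead_mon R r f = p @ lead_mon R r g @ q"
      by (auto simp: sublist_def)
    then have pqX: "p \<in> lists X" "q \<in> lists X"
      using lead_mon_in_lists[OF r fc] by auto
    have c: "lead_coef R r g \<in> carrier R"
      using gc by (auto simp: lead_coef_def free_alg_coeff_closed)
    have "lead_term R r f
        = word_term R \<one>\<^bsub>R\<^esub> p \<otimes>\<^bsub>?A\<^esub> (lead_term R r g \<otimes>\<^bsub>?A\<^esub> word_term R d q)"
      using c d(1) by (simp add: lead_term_def word_term_mult_word_term R pq d(2))
    also have "\<dots> \<in> lead_ideal R X r G"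
      using lg pqX d(1) by (intro L.I_l_closed L.I_r_closed word_term_in_carrier) (auto simp: R)
    finally show ?thesis .
  qed
  then show ?thesis
    unfolding lead_ideal_def[of R X r I] by (intro A.genideal_minimal L.ideal_axioms) auto
qed

section \<open>Reduction of coefficients\<close>

lemma ZFact_simps:
  "\<zero>\<^bsub>ZFact m\<^esub> = Idl\<^bsub>\<Z>\<^esub> {m}"
  "(Idl\<^bsub>\<Z>\<^esub> {m} +>\<^bsub>\<Z>\<^esub> a) \<otimes>\<^bsub>ZFact m\<^esub> (Idl\<^bsub>\<Z>\<^esub> {m} +>\<^bsub>\<Z>\<^esub> b) = Idl\<^bsub>\<Z>\<^esub> {m} +>\<^bsub>\<Z>\<^esub> (a * b)"
  "c \<in> carrier (ZFact m) \<longleftrightarrow> (\<exists>a. c = Idl\<^bsub>\<Z>\<^esub> {m} +>\<^bsub>\<Z>\<^esub> a)"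
proof -
  interpret ideal "Idl\<^bsub>\<Z>\<^esub> {m}" \<Z> by (rule int.genideal_ideal) simp
  show "\<zero>\<^bsub>ZFact m\<^esub> = Idl\<^bsub>\<Z>\<^esub> {m}"
    by (simp add: ZFact_defs)
  show "(Idl\<^bsub>\<Z>\<^esub> {m} +>\<^bsub>\<Z>\<^esub> a) \<otimes>\<^bsub>ZFact m\<^esub> (Idl\<^bsub>\<Z>\<^esub> {m} +>\<^bsub>\<Z>\<^esub> b) = Idl\<^bsub>\<Z>\<^esub> {m} +>\<^bsub>\<Z>\<^esub> (a * b)"
    using rcoset_mult_add[of a b] by (simp add: ZFact_defs)
  show "c \<in> carrier (ZFact m) \<longleftrightarrow> (\<exists>a. c = Idl\<^bsub>\<Z>\<^esub> {m} +>\<^bsub>\<Z>\<^esub> a)"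
    by (auto simp: ZFact_defs A_RCOSETS_def' a_r_coset_def RCOSETS_def)
qed

lemma ZFact_coset_eq_iff: "Idl\<^bsub>\<Z>\<^esub> {m} +>\<^bsub>\<Z>\<^esub> a = Idl\<^bsub>\<Z>\<^esub> {m} +>\<^bsub>\<Z>\<^esub> b \<longleftrightarrow> m dvd a - b"
proof -
  have "ZMod m a = ZMod m b \<longleftrightarrow> a mod m = b mod m"
    using ZMod_imp_zmod zmod_imp_ZMod by blast
  then show ?thesis by (simp add: ZMod_def mod_eq_dvd_iff)
qed

lemma ZFact_coset_eq_zero_iff: "Idl\<^bsub>\<Z>\<^esub> {m} +>\<^bsub>\<Z>\<^esub> a = \<zero>\<^bsub>ZFact m\<^esub> \<longleftrightarrow> m dvd a"
proof -
  have "\<zero>\<^bsub>ZFact m\<^esub> = Idl\<^bsub>\<Z>\<^esub> {m} +>\<^bsub>\<Z>\<^esub> 0"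
    by (simp add: ZFact_simps a_r_coset_def')
  then show ?thesis by (simp only: ZFact_coset_eq_iff diff_zero)
qed

lemma proj_mod_eq_iff: "proj_mod m f = proj_mod m g \<longleftrightarrow> (\<forall>w. m dvd f w - g w)"
  by (auto simp: proj_mod_def fun_eq_iff ZFact_coset_eq_iff)

text \<open>
  Reduction can only delete words from the support, and the leading one stays as long as its
  coefficient is not a multiple of \<open>m\<close>.
\<close>

lemma lead_term_proj_mod:
  assumes "well_order_on (lists X) r" and f: "f \<in> carrier (free_alg \<Z> X)"
    and m: "\<not> m dvd lead_coef \<Z> r f"
  shows "lead_term (ZFact m) r (proj_mod m f)
       = word_term (ZFact m) (Idl\<^bsub>\<Z>\<^esub> {m} +>\<^bsub>\<Z>\<^esub> lead_coef \<Z> r f) (lead_mon \<Z> r f)"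
proof -
  have "f \<noteq> \<zero>\<^bsub>free_alg \<Z> X\<^esub>" using m by (auto simp: lead_coef_def free_alg_simps)
  note greatest = lead_mon_greatest[OF assms(1) f this]
  have "lead_mon (ZFact m) r (proj_mod m f) = lead_mon \<Z> r f"
  proof (rule lead_mon_eqI[OF assms(1)])
    show "proj_mod m f (lead_mon \<Z> r f) \<noteq> \<zero>\<^bsub>ZFact m\<^esub>"
      using m by (simp add: proj_mod_def ZFact_coset_eq_zero_iff lead_coef_def)
  next
    fix v assume "proj_mod m f v \<noteq> \<zero>\<^bsub>ZFact m\<^esub>"
    then have "\<not> m dvd f v" by (simp add: proj_mod_def ZFact_coset_eq_zero_iff)
    then have "f v \<noteq> 0" by auto
    then show "(v, lead_mon \<Z> r f) \<in> r" using greatest by simp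
  qed
  then show ?thesis by (simp add: lead_term_def lead_coef_def proj_mod_def)
qed

text \<open>
  Divisibility modulo \<open>m\<close> is a congruence \<open>lc f \<equiv> lc g \<cdot> e (mod m)\<close>. As \<open>lc g\<close> divides \<open>m\<close>, it
  divides the difference of the two sides as well, hence \<open>lc f\<close> itself.
\<close>

lemma term_divides_lift:
  assumes r: "well_order_on (lists X) r"
    and f: "f \<in> carrier (free_alg \<Z> X)" "\<not> m dvd lead_coef \<Z> r f"
    and g: "g \<in> carrier (free_alg \<Z> X)" "\<not> m dvd lead_coef \<Z> r g"
    and gm: "lead_coef \<Z> r g dvd m"
    and div: "term_divides (ZFact m) (lead_term (ZFact m) r (proj_mod m g))
                (lead_term (ZFact m) r (proj_mod m f))"
  shows "term_divides \<Z> (lead_term \<Z> r g) (lead_term \<Z> r f)"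
proof -
  have "(Idl\<^bsub>\<Z>\<^esub> {m} +>\<^bsub>\<Z>\<^esub> lead_coef \<Z> r g) divides\<^bsub>ZFact m\<^esub> (Idl\<^bsub>\<Z>\<^esub> {m} +>\<^bsub>\<Z>\<^esub> lead_coef \<Z> r f)"
    and sl: "sublist (lead_mon \<Z> r g) (lead_mon \<Z> r f)"
    using div f(2) g(2)
    by (simp_all add: lead_term_proj_mod[OF r f] lead_term_proj_mod[OF r g]
        term_divides_word_term_iff ZFact_coset_eq_zero_iff)
  then obtain e where "m dvd lead_coef \<Z> r f - lead_coef \<Z> r g * e"
    by (auto simp: factor_def ZFact_simps ZFact_coset_eq_iff)
  then have "lead_coef \<Z> r g dvd (lead_coef \<Z> r f - lead_coef \<Z> r g * e) + lead_coef \<Z> r g * e"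
    using gm by (intro dvd_add) (auto intro: dvd_trans)
  then have "lead_coef \<Z> r g divides\<^bsub>\<Z>\<^esub> lead_coef \<Z> r f"
    by (auto simp: factor_def dvd_def)
  moreover have "lead_coef \<Z> r g \<noteq> 0" "lead_coef \<Z> r f \<noteq> 0" using f g by auto
  ultimately show ?thesis
    using sl by (simp add: lead_term_def term_divides_word_term_iff)
qed

section \<open>The preimage of the reduced ideal\<close>

lemma (in ring) central_multiples_ideal:
  assumes c: "c \<in> carrier R" and central: "\<And>x. x \<in> carrier R \<Longrightarrow> x \<otimes> c = c \<otimes> x"
  shows "ideal (c <#\<^bsub>R\<^esub> carrier R) R"
proof (rule idealI[OF ring_axioms])
  show "subgroup (c <#\<^bsub>R\<^esub> carrier R) (add_monoid R)"
  proof (rule add.subgroupI)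
    show "c <#\<^bsub>R\<^esub> carrier R \<subseteq> carrier R" "c <#\<^bsub>R\<^esub> carrier R \<noteq> {}"
      using c by (auto simp: l_coset_def)
    fix a b assume "a \<in> c <#\<^bsub>R\<^esub> carrier R" "b \<in> c <#\<^bsub>R\<^esub> carrier R"
    then obtain x y where "x \<in> carrier R" "y \<in> carrier R" "a = c \<otimes> x" "b = c \<otimes> y"
      by (auto simp: l_coset_def)
    then have "\<ominus> a = c \<otimes> (\<ominus> x)" "a \<oplus> b = c \<otimes> (x \<oplus> y)"
      "\<ominus> x \<in> carrier R" "x \<oplus> y \<in> carrier R"
      using c by (simp_all add: r_minus r_distr)
    then show "\<ominus> a \<in> c <#\<^bsub>R\<^esub> carrier R" "a \<oplus> b \<in> c <#\<^bsub>R\<^esub> carrier R"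
      unfolding l_coset_def by blast+
  qed
next
  fix a x assume "a \<in> c <#\<^bsub>R\<^esub> carrier R" and x: "x \<in> carrier R"
  then obtain y where y: "y \<in> carrier R" "a = c \<otimes> y"
    by (auto simp: l_coset_def)
  have "x \<otimes> a = c \<otimes> (x \<otimes> y)" using x y c central by (metis m_assoc)
  moreover have "a \<otimes> x = c \<otimes> (y \<otimes> x)" using x y c by (simp add: m_assoc)
  ultimately show "x \<otimes> a \<in> c <#\<^bsub>R\<^esub> carrier R" "a \<otimes> x \<in> c <#\<^bsub>R\<^esub> carrier R"
    using x y by (auto simp: l_coset_def)
qed

text \<open>
  The coefficients of \<open>f - i\<close> are multiples of \<open>m\<close> exactly when \<open>f - i = m h\<close> for the coefficientwise
  quotient \<open>h\<close>, which is again finitely supported.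
\<close>

lemma mem_ideal_plus_multiples_iff:
  assumes I: "ideal I (free_alg \<Z> X)"
  shows "f \<in> I <+>\<^bsub>free_alg \<Z> X\<^esub> (word_term \<Z> m [] <#\<^bsub>free_alg \<Z> X\<^esub> carrier (free_alg \<Z> X)) \<longleftrightarrow>
         f \<in> carrier (free_alg \<Z> X) \<and> proj_mod m f \<in> proj_mod m ` I" (is "?L \<longleftrightarrow> ?R")
proof -
  let ?P = "free_alg \<Z> X"
  have Z: "ring \<Z>" using int_is_cring by (rule cring.axioms)
  interpret I: ideal I ?P by fact
  have mc: "word_term \<Z> m [] \<in> carrier ?P" by (rule word_term_in_carrier[OF Z]) auto
  have const: "word_term \<Z> m [] \<otimes>\<^bsub>?P\<^esub> h = (\<lambda>w. m * h w)" if "h \<in> carrier ?P" for h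
    using constant_mult(1)[OF Z _ that, of m] by simp
  show ?thesis
  proof
    assume ?L
    then obtain i h where i: "i \<in> I" and h: "h \<in> carrier ?P"
      and f: "f = i \<oplus>\<^bsub>?P\<^esub> word_term \<Z> m [] \<otimes>\<^bsub>?P\<^esub> h"
      by (auto simp: set_add_def' l_coset_def)
    have "f \<in> carrier ?P"
      unfolding f using i h mc I.a_Hcarr by (intro I.a_closed I.m_closed) auto
    moreover have "proj_mod m f = proj_mod m i"
      by (simp add: f const[OF h] free_alg_simps proj_mod_eq_iff)
    ultimately show ?R using i by auto
  next
    assume ?R
    then obtain i where f: "f \<in> carrier ?P" and i: "i \<in> I" and eq: "\<And>w. m dvd f w - i w"
      by (auto simp: proj_mod_eq_iff)
    have ic: "i \<in> carrier ?P" using i I.a_Hcarr by auto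
    define h where "h w = (f w - i w) div m" for w
    have supp: "{w. h w \<noteq> 0} \<subseteq> {w. f w \<noteq> 0} \<union> {w. i w \<noteq> 0}" by (auto simp: h_def)
    then have "finite {w. h w \<noteq> 0}"
      using free_alg_support(1)[OF f] free_alg_support(1)[OF ic]
      by (intro finite_subset[OF supp]) auto
    moreover have "{w. h w \<noteq> 0} \<subseteq> lists X"
      using supp free_alg_support(2)[OF f] free_alg_support(2)[OF ic] by auto
    ultimately have h: "h \<in> carrier ?P" by (auto simp: free_alg_def)
    have "f = i \<oplus>\<^bsub>?P\<^esub> word_term \<Z> m [] \<otimes>\<^bsub>?P\<^esub> h"
      using eq by (simp add: const[OF h] free_alg_simps fun_eq_iff h_def)
    then show ?L using i h unfolding set_add_def' l_coset_def by blast
  qed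
qed

lemma ideal_plus_multiples_ideal:
  assumes I: "ideal I (free_alg \<Z> X)"
  shows "ideal (I <+>\<^bsub>free_alg \<Z> X\<^esub> (word_term \<Z> m [] <#\<^bsub>free_alg \<Z> X\<^esub> carrier (free_alg \<Z> X)))
           (free_alg \<Z> X)"
proof -
  have Z: "ring \<Z>" using int_is_cring by (rule cring.axioms)
  interpret P: ring "free_alg \<Z> X" using Z by (rule ring.free_alg_ring)
  have "ideal (word_term \<Z> m [] <#\<^bsub>free_alg \<Z> X\<^esub> carrier (free_alg \<Z> X)) (free_alg \<Z> X)"
    by (rule P.central_multiples_ideal)
      (auto simp: constant_mult[OF Z] mult.commute intro: word_term_in_carrier[OF Z])
  then show ?thesis by (rule P.add_ideals[OF I])
qed

section \<open>Lifting the Groebner basis\<close>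

theorem theorem18:
  fixes X :: "'x set" and r :: "'x list rel" and m :: int
    and I G :: "('x list \<Rightarrow> int) set"
  assumes "finite X"
    and "monomial_well_order X r"
    and "m \<noteq> 0"
    and "ideal I (free_alg \<Z> X)"
    and "G \<subseteq> carrier (free_alg \<Z> X)"
    and "strong_groebner_basis (ZFact m) X r (proj_mod m ` G) (proj_mod m ` I)"
    and "\<And>g. g \<in> G \<Longrightarrow> \<not> m dvd lead_coef \<Z> r g"
    and "\<And>g. g \<in> G \<Longrightarrow> lead_coef \<Z> r g dvd m"
  shows "strong_groebner_basis \<Z> X r (G \<union> {word_term \<Z> m []})
           (I <+>\<^bsub>free_alg \<Z> X\<^esub> (word_term \<Z> m [] <#\<^bsub>free_alg \<Z> X\<^esub> carrier (free_alg \<Z> X)))"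
proof -
  let ?P = "free_alg \<Z> X" and ?m = "word_term \<Z> m []"
  define J where "J = I <+>\<^bsub>?P\<^esub> (?m <#\<^bsub>?P\<^esub> carrier ?P)"
  have Z: "ring \<Z>" using int_is_cring by (rule cring.axioms)
  have r: "well_order_on (lists X) r" using assms(2) by (simp add: monomial_well_order_def)
  interpret I: ideal I ?P by fact
  have J: "f \<in> J \<longleftrightarrow> f \<in> carrier ?P \<and> proj_mod m f \<in> proj_mod m ` I" for f
    unfolding J_def by (rule mem_ideal_plus_multiples_iff[OF assms(4)])
  have mc: "?m \<in> carrier ?P" by (rule word_term_in_carrier[OF Z]) auto
  have m0: "?m \<noteq> \<zero>\<^bsub>?P\<^esub>"
    using assms(3) by (auto simp: free_alg_simps word_term_def fun_eq_iff)
  have ltm: "lead_term \<Z> r ?m = ?m"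
  proof -
    have "lead_mon \<Z> r ?m = []"
      using lead_coef_nonzero[OF r mc m0] by (auto simp: lead_coef_def word_term_def split: if_splits)
    then show ?thesis by (simp add: lead_term_def lead_coef_def word_term_def)
  qed
  have G0: "g \<noteq> \<zero>\<^bsub>?P\<^esub>" if "g \<in> G" for g
    using assms(7)[OF that] by (auto simp: lead_coef_def free_alg_simps)
  have "proj_mod m ` G \<subseteq> proj_mod m ` I"
    using assms(6) by (auto simp: strong_groebner_basis_def)
  then have "G \<subseteq> J" using assms(5) J by blast
  moreover have "?m \<in> J"
  proof -
    have "proj_mod m ?m = proj_mod m \<zero>\<^bsub>?P\<^esub>"
      by (auto simp: proj_mod_eq_iff word_term_def free_alg_simps)
    then show ?thesis using mc by (simp add: J)
  qed
  ultimately have sub: "G \<union> {?m} \<subseteq> J - {\<zero>\<^bsub>?P\<^esub>}" using G0 m0 by auto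
  have div: "\<exists>g\<in>G \<union> {?m}. term_divides \<Z> (lead_term \<Z> r g) (lead_term \<Z> r f)"
    if "f \<in> J - {\<zero>\<^bsub>?P\<^esub>}" for f
  proof (cases "m dvd lead_coef \<Z> r f")
    case True
    have "lead_coef \<Z> r f \<noteq> 0"
      using lead_coef_nonzero[OF r, of f \<Z>] that by (simp add: J)
    then have "term_divides \<Z> (lead_term \<Z> r ?m) (lead_term \<Z> r f)"
      unfolding ltm using True assms(3)
      by (auto simp: lead_term_def term_divides_word_term_iff factor_def dvd_def)
    then show ?thesis by blast
  next
    case False
    have f: "f \<in> carrier ?P" "proj_mod m f \<in> proj_mod m ` I" using that J by auto
    moreover have "proj_mod m f \<noteq> \<zero>\<^bsub>free_alg (ZFact m) X\<^esub>"
    proof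
      assume "proj_mod m f = \<zero>\<^bsub>free_alg (ZFact m) X\<^esub>"
      from fun_cong[OF this, of "lead_mon \<Z> r f"] show False
        using False by (simp add: free_alg_simps proj_mod_def ZFact_coset_eq_zero_iff lead_coef_def)
    qed
    ultimately obtain g where g: "g \<in> G"
      and "term_divides (ZFact m) (lead_term (ZFact m) r (proj_mod m g))
             (lead_term (ZFact m) r (proj_mod m f))"
      using assms(6) unfolding strong_groebner_basis_def by blast
    then have "term_divides \<Z> (lead_term \<Z> r g) (lead_term \<Z> r f)"
      using assms(5,7,8) False f(1) by (intro term_divides_lift[OF r]) auto
    then show ?thesis using g by blast
  qed
  have "countable (carrier ?P)"
    by (rule countable_free_alg[OF countable_finite[OF assms(1)]]) simp
  then have "countable (G \<union> {?m})" using assms(5) by (auto intro: countable_subset)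
  moreover have "lead_ideal \<Z> X r J \<subseteq> lead_ideal \<Z> X r (G \<union> {?m})"
    using J by (intro lead_ideal_subset[OF Z r _ sub div]) auto
  moreover have "ideal J ?P" unfolding J_def by (rule ideal_plus_multiples_ideal[OF assms(4)])
  ultimately show ?thesis
    using sub div unfolding strong_groebner_basis_def J_def[symmetric] by blast
qed

end
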